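(* Let $q\ge0$ and let $W^{(q)}$ be the $q$-scale function of the spectrally negative compound Poisson process $L_t=ct-\sum_{i=1}^{N_t}\xi_i$ with drift $c>0$, intensity $\lambda>0$ and jump distribution $\Pi$. Then the primitive of $W^{(q)}$ is given by $$\int_0^x W^{(q)}(y)\,\mathrm{d}y=\frac1c\sum_{k=0}^\infty\int_{[0,x)}\int_s^x g_k(s,y)\,\mathrm{d}y\,\Pi^{*k}(\mathrm{d}s),\qquad x\ge0,$$ where $g_k(s,x)=\frac{(\lambda/c)^k}{k!}e^{-\frac{q+\lambda}{c}(s-x)}(s-x)^k$ for $s,x\ge0$, $k\in\mathbb{N}$.
   Context: Here $\mathbb{N}=\{0,1,2,\dots\}$. $(N_t)_{t\ge0}$ is a Poisson process with intensity $\lambda>0$, and $(\xi_i)_{i\ge1}$ are i.i.d., independent of $(N_t)$, with law $\Pi$, a probability measure on $(0,\infty)$. The Laplace exponent is $\psi(u)=\log\mathbb{E}[e^{uL_1}]=cu+\lambda\int_{(0,\infty)}(e^{-ux}-1)\,\Pi(\mathrm{d}x)$, $u\ge0$. For $q\ge0$ put $\Phi(q)=\sup\{y\ge0:\psi(y)=q\}$; the $q$-scale function $W^{(q)}:[0,\infty)\to\mathbb{R}$ is the unique continuous function with $\int_0^\infty e^{-\beta x}W^{(q)}(x)\,\mathrm{d}x=\frac1{\psi(\beta)-q}$ for all $\beta>\Phi(q)$. $\Pi^{*k}$ is the $k$-th convolution power of $\Pi$, with $\Pi^{*0}=\delta_0$. Convention: $0^0=1$. *)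

theory Defs
  imports "HOL-Probability.Probability"
begin

text \<open>
  Increments are taken in \<^typ>\<open>int\<close> since subtraction on \<^typ>\<open>nat\<close> truncates and
  monotonicity is only required almost surely. The topology on \<^typ>\<open>nat\<close> is discrete, so
  right-continuity says that paths are locally constant to the right of every time.
\<close>

locale poisson_process = prob_space M for M :: "'a measure" +
  fixes N :: "real \<Rightarrow> 'a \<Rightarrow> nat" and rate :: real
  assumes rate_pos: "rate > 0"
    and N_measurable: "\<And>t. t \<ge> 0 \<Longrightarrow> N t \<in> measurable M (count_space UNIV)"
    and N_zero: "AE \<omega> in M. N 0 \<omega> = 0"
    and N_paths: "AE \<omega> in M. mono_on {0..} (\<lambda>t. N t \<omega>) \<and>
                    (\<forall>t\<ge>0. continuous (at_right t) (\<lambda>s. N s \<omega>))"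
    and N_indep_increments:
      "\<And>(t :: nat \<Rightarrow> real) n. 0 \<le> t 0 \<Longrightarrow> (\<And>i. i < n \<Longrightarrow> t i < t (Suc i)) \<Longrightarrow>
         indep_vars (\<lambda>_. count_space UNIV)
           (\<lambda>i \<omega>. int (N (t (Suc i)) \<omega>) - int (N (t i) \<omega>)) {..<n}"
    and N_increments_poisson:
      "\<And>s t. 0 \<le> s \<Longrightarrow> s < t \<Longrightarrow>
         distr M (count_space UNIV) (\<lambda>\<omega>. int (N t \<omega>) - int (N s \<omega>)) =
         measure_pmf (map_pmf int (poisson_pmf (rate * (t - s))))"

text \<open>
  The data of a spectrally negative compound Poisson process with drift \<open>c\<close>: the jump
  distribution \<open>\<nu>\<close> is a probability measure on the Borel sets of the reals that is carried by
  the open positive half-line. The last assumption says that the whole process \<open>N\<close>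
  is independent of the whole sequence \<open>\<xi>\<close>.
\<close>

locale negative_compound_poisson = poisson_process M N rate
  for M :: "'a measure" and N :: "real \<Rightarrow> 'a \<Rightarrow> nat" and rate :: real +
  fixes \<xi> :: "nat \<Rightarrow> 'a \<Rightarrow> real" and \<nu> :: "real measure" and c :: real
  assumes drift_pos: "c > 0"
    and \<nu>_prob: "prob_space \<nu>"
    and \<nu>_sets: "sets \<nu> = sets borel"
    and \<nu>_positive: "emeasure \<nu> {..0} = 0"
    and \<xi>_indep: "indep_vars (\<lambda>_. borel) \<xi> {1..}"
    and \<xi>_distr: "\<And>i. i \<ge> 1 \<Longrightarrow> distr M borel (\<xi> i) = \<nu>"
    and N_indep_\<xi>:
      "indep_var (PiM {0..} (\<lambda>_. count_space UNIV)) (\<lambda>\<omega>. \<lambda>t\<in>{0..}. N t \<omega>)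
                 (PiM {1..} (\<lambda>_. borel)) (\<lambda>\<omega>. \<lambda>i\<in>{1..}. \<xi> i \<omega>)"

definition cpp :: "real \<Rightarrow> (real \<Rightarrow> 'a \<Rightarrow> nat) \<Rightarrow> (nat \<Rightarrow> 'a \<Rightarrow> real) \<Rightarrow> real \<Rightarrow> 'a \<Rightarrow> real" where
  "cpp c N \<xi> t \<omega> = c * t - (\<Sum>i=1..N t \<omega>. \<xi> i \<omega>)"

definition laplace_exponent :: "'a measure \<Rightarrow> (real \<Rightarrow> 'a \<Rightarrow> real) \<Rightarrow> real \<Rightarrow> real" where
  "laplace_exponent M L u = ln (LINT \<omega>|M. exp (u * L 1 \<omega>))"

definition right_inverse :: "(real \<Rightarrow> real) \<Rightarrow> real \<Rightarrow> real" where
  "right_inverse \<psi> q = Sup {y. 0 \<le> y \<and> \<psi> y = q}"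

text \<open>Only the values of \<open>W\<close> on the closed half-line from \<open>0\<close> matter.\<close>

definition is_scale_function :: "(real \<Rightarrow> real) \<Rightarrow> real \<Rightarrow> (real \<Rightarrow> real) \<Rightarrow> bool" where
  "is_scale_function \<psi> q W \<longleftrightarrow>
     continuous_on {0..} W \<and>
     (\<forall>\<beta> > right_inverse \<psi> q.
        set_integrable lborel {0..} (\<lambda>x. exp (- \<beta> * x) * W x) \<and>
        (LBINT x:{0..}. exp (- \<beta> * x) * W x) = 1 / (\<psi> \<beta> - q))"

primrec conv_power :: "real measure \<Rightarrow> nat \<Rightarrow> real measure" where
  "conv_power \<nu> 0 = return borel 0"
| "conv_power \<nu> (Suc k) = convolution (conv_power \<nu> k) \<nu>"

definition g :: "real \<Rightarrow> real \<Rightarrow> real \<Rightarrow> nat \<Rightarrow> real \<Rightarrow> real \<Rightarrow> real" where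
  "g c rate q k s x =
     (rate / c) ^ k / fact k * exp (- ((q + rate) / c) * (s - x)) * (s - x) ^ k"

end

theory Submission
  imports Defs
begin

text \<open>
  With \<open>a = (q + rate) / c\<close>, \<open>b = rate / c\<close> and \<open>h = \<integral> exp (- \<beta> s) \<nu>(ds)\<close>, the transform of the scale
  function expands for large \<open>\<beta>\<close> as
  \<open>1 / (\<psi>(\<beta>) - q) = (1 / c) / (\<beta> - a + b h) = (1 / c) \<Sum>k. (- b h)^k / (\<beta> - a)^(k + 1)\<close>.
  The \<open>k\<close>-th summand is the Laplace transform of \<open>y \<mapsto> \<integral> g_k(s, y) \<nu>^{*k}(ds)\<close> over \<open>[0, y]\<close>, an Erlang
  integral. These functions are dominated by the terms of the series of \<open>exp (a y) exp (b y)\<close>, so sums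
  and integrals may be exchanged, and injectivity of the Laplace transform identifies the primitives.
\<close>

section \<open>Convolution powers\<close>

lemma prob_space_convolution:
  fixes \<mu> \<nu> :: "real measure"
  assumes "prob_space \<mu>" "prob_space \<nu>"
    and [measurable_cong]: "sets \<mu> = sets borel" "sets \<nu> = sets borel"
  shows "prob_space (convolution \<mu> \<nu>)"
proof -
  interpret \<mu>: prob_space \<mu> by fact
  interpret \<nu>: prob_space \<nu> by fact
  interpret P: pair_prob_space \<mu> \<nu> ..
  show ?thesis
    unfolding convolution_def by (rule P.prob_space_distr) measurable
qed

lemma sets_conv_power [measurable_cong]: "sets (conv_power \<nu> k) = sets borel"
  by (cases k) auto

lemma prob_space_conv_power:
  assumes "prob_space \<nu>" "sets \<nu> = sets borel"
  shows "prob_space (conv_power \<nu> k)"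
proof (induction k)
  case 0
  show ?case by (simp add: prob_space_return)
next
  case (Suc k)
  show ?case
    unfolding conv_power.simps
    by (rule prob_space_convolution[OF Suc.IH assms(1) sets_conv_power assms(2)])
qed

text \<open>The exponential turns the sum inside a convolution into a product. In
  \<open>ennreal\<close> the induction needs no integrability and covers every real
  \<open>u\<close>.\<close>

lemma nn_integral_conv_power_exp:
  assumes "prob_space \<nu>" and [measurable_cong]: "sets \<nu> = sets borel"
  shows "(\<integral>\<^sup>+s. ennreal (exp (- u * s)) \<partial>conv_power \<nu> k) = (\<integral>\<^sup>+s. ennreal (exp (- u * s)) \<partial>\<nu>) ^ k"
proof (induction k)
  case 0
  show ?case by (simp add: nn_integral_return)
next
  case (Suc k)
  have "(\<integral>\<^sup>+s. ennreal (exp (- u * s)) \<partial>conv_power \<nu> (Suc k)) =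
      (\<integral>\<^sup>+x. \<integral>\<^sup>+y. ennreal (exp (- u * (x + y))) \<partial>\<nu> \<partial>conv_power \<nu> k)"
    unfolding conv_power.simps
    by (rule nn_integral_convolution)
       (use assms in \<open>simp_all add: sets_conv_power prob_space_conv_power prob_space.finite_measure\<close>)
  also have "\<dots> = (\<integral>\<^sup>+x. ennreal (exp (- u * x)) * (\<integral>\<^sup>+y. ennreal (exp (- u * y)) \<partial>\<nu>) \<partial>conv_power \<nu> k)"
    by (intro nn_integral_cong, subst nn_integral_cmult [symmetric])
       (auto simp: distrib_left exp_add ennreal_mult exp_diff exp_minus divide_inverse)
  also have "\<dots> = (\<integral>\<^sup>+s. ennreal (exp (- u * s)) \<partial>\<nu>) ^ Suc k"
    by (subst nn_integral_multc) (simp_all only: Suc.IH power_Suc2, simp_all)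
  finally show ?case .
qed

text \<open>A convolution is the image of a product measure under addition, so the claim reduces to
  pairs of nonnegative summands. It confines the kernels to \<open>0 \<le> s\<close>, where their
  transforms are computed.\<close>

lemma AE_conv_power_nonneg:
  assumes "prob_space \<nu>" and [measurable_cong]: "sets \<nu> = sets borel"
    and pos: "AE s in \<nu>. 0 \<le> s"
  shows "AE s in conv_power \<nu> k. 0 \<le> s"
proof (induction k)
  case 0
  have "AE s in return borel 0. 0 \<le> (s :: real)"
    by (subst AE_return) auto
  then show ?case unfolding conv_power.simps .
next
  case (Suc k)
  interpret \<nu>: prob_space \<nu> by fact
  interpret \<mu>: prob_space "conv_power \<nu> k"
    by (rule prob_space_conv_power) (use assms in auto)
  interpret P: pair_sigma_finite "conv_power \<nu> k" \<nu> ..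
  have "AE p in conv_power \<nu> k \<Otimes>\<^sub>M \<nu>. 0 \<le> fst p + snd p"
  proof (rule P.AE_pair_measure)
    show "{p \<in> space (conv_power \<nu> k \<Otimes>\<^sub>M \<nu>). 0 \<le> fst p + snd p} \<in> sets (conv_power \<nu> k \<Otimes>\<^sub>M \<nu>)"
      by measurable
    have sum: "AE y in \<nu>. 0 \<le> fst (x, y) + snd (x, y)" if "0 \<le> x" for x
      using pos by eventually_elim (use that in simp)
    show "AE x in conv_power \<nu> k. AE y in \<nu>. 0 \<le> fst (x, y) + snd (x, y)"
      using Suc.IH by eventually_elim (rule sum)
  qed
  then have AE: "AE p in conv_power \<nu> k \<Otimes>\<^sub>M \<nu>. 0 \<le> (case p of (x, y) \<Rightarrow> x + y)"
    by (simp only: case_prod_beta)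
  have "(\<lambda>(x, y). x + y) \<in> borel_measurable (conv_power \<nu> k \<Otimes>\<^sub>M \<nu>)"
    by measurable
  moreover have "{s \<in> space borel. 0 \<le> (s :: real)} \<in> sets borel"
    by measurable
  ultimately show ?case
    unfolding conv_power.simps convolution_def using AE by (rule iffD2[OF AE_distr_iff])
qed

lemma integrable_exp_neg:
  assumes "prob_space \<mu>" and [measurable_cong]: "sets \<mu> = sets borel"
    and pos: "AE s in \<mu>. 0 \<le> s" and u: "0 \<le> (u::real)"
  shows "integrable \<mu> (\<lambda>s. exp (- u * s))"
proof -
  interpret prob_space \<mu> by fact
  have "AE s in \<mu>. norm (exp (- u * s)) \<le> 1"
    using pos by eventually_elim (use u in simp)
  then show ?thesis
    by (rule integrable_const_bound) measurable
qed

text \<open>On a nonnegative support the exponentials are at most 1, hence integrable, and the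
  \<open>ennreal\<close> identity transfers to real integrals.\<close>

lemma integral_conv_power_exp:
  assumes "prob_space \<nu>" and "sets \<nu> = sets borel"
    and "AE s in \<nu>. 0 \<le> s" and u: "0 \<le> (u::real)"
  shows "(LINT s|conv_power \<nu> k. exp (- u * s)) = (LINT s|\<nu>. exp (- u * s)) ^ k"
proof -
  have "integrable \<nu> (\<lambda>s. exp (- u * s))"
    using assms by (rule integrable_exp_neg)
  moreover have "integrable (conv_power \<nu> k) (\<lambda>s. exp (- u * s))"
    using assms by (intro integrable_exp_neg prob_space_conv_power AE_conv_power_nonneg sets_conv_power)
  ultimately have "ennreal (LINT s|conv_power \<nu> k. exp (- u * s)) = ennreal ((LINT s|\<nu>. exp (- u * s)) ^ k)"
    using nn_integral_conv_power_exp[OF assms(1,2), where u = u and k = k]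
    by (simp add: nn_integral_eq_integral ennreal_power)
  then show ?thesis
    by (subst (asm) ennreal_inj) auto
qed

section \<open>Injectivity of the Laplace transform\<close>

text \<open>Under \<open>u = exp (- y)\<close> the function \<open>H\<close> becomes a signed
  measure of finite total variation on the unit interval, all of whose moments vanish. Polynomials
  are uniformly dense in the continuous functions there (Stone-Weierstrass).\<close>

lemma integral_continuous_exp_neg_eq_0:
  fixes H :: "real \<Rightarrow> real"
  assumes H: "integrable lborel H" "\<And>y. y < 0 \<Longrightarrow> H y = 0"
    and zero: "\<And>n. (LBINT y. exp (- real n * y) * H y) = 0"
    and int: "\<And>n. integrable lborel (\<lambda>y. exp (- real n * y) * H y)"
    and F: "continuous_on UNIV F"
  shows "(LBINT y. F (exp (- y)) * H y) = (0::real)"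
proof -
  have [measurable]: "F \<in> borel_measurable borel" "H \<in> borel_measurable borel"
    using F H by (auto intro: borel_measurable_continuous_onI)
  \<comment> \<open>A bound on the unit interval suffices: \<open>H\<close> vanishes at negative
    \<open>y\<close>, and for all other \<open>y\<close> the point \<open>exp (- y)\<close> lies in
    it.\<close>
  obtain C where C: "\<And>x. x \<in> {0..1} \<Longrightarrow> \<bar>F x\<bar> \<le> C"
  proof -
    have "bounded (F ` {0..1})"
      by (intro compact_imp_bounded compact_continuous_image continuous_on_subset[OF F]) auto
    then show ?thesis using that by (force simp: bounded_iff)
  qed
  have FH: "integrable lborel (\<lambda>y. F (exp (- y)) * H y)"
  proof (rule Bochner_Integration.integrable_bound)
    show "integrable lborel (\<lambda>y. C * \<bar>H y\<bar>)" using H by auto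
    have "\<bar>F (exp (- y)) * H y\<bar> \<le> \<bar>C * \<bar>H y\<bar>\<bar>" for y
    proof (cases "y < 0")
      case False
      then have "\<bar>F (exp (- y))\<bar> \<le> C" by (intro C) auto
      moreover from this have "0 \<le> C" by linarith
      ultimately show ?thesis
        by (simp add: abs_mult mult_right_mono)
    qed (use H in auto)
    then show "AE y in lborel. norm (F (exp (- y)) * H y) \<le> norm (C * \<bar>H y\<bar>)" by simp
  qed measurable
  define I where "I = (LBINT y. \<bar>H y\<bar>)"
  have I: "0 \<le> I" by (simp add: I_def)
  have bound: "\<bar>LBINT y. F (exp (- y)) * H y\<bar> \<le> e * I" if e: "e > 0" for e
  proof -
    obtain p where p: "real_polynomial_function p" "\<And>x. x \<in> {0..1} \<Longrightarrow> \<bar>F x - p x\<bar> < e"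
      using Stone_Weierstrass_real_polynomial_function[OF compact_Icc continuous_on_subset[OF F subset_UNIV] e]
      by metis
    then obtain a n where p_eq: "p = (\<lambda>x. \<Sum>i\<le>n. a i * x ^ i)"
      by (auto simp: real_polynomial_function_iff_sum)
    have pe: "p (exp (- y)) * H y = (\<Sum>i\<le>n. a i * (exp (- real i * y) * H y))" for y
    proof -
      have "exp (- real i * y) = exp (- y) ^ i" for i
        using exp_of_nat_mult[of i "- y"] by simp
      then show ?thesis by (simp add: p_eq sum_distrib_right mult.assoc)
    qed
    have pH: "integrable lborel (\<lambda>y. p (exp (- y)) * H y)"
      unfolding pe by (intro Bochner_Integration.integrable_sum integrable_mult_right int)
    have "(LBINT y. p (exp (- y)) * H y) = (\<Sum>i\<le>n. LBINT y. a i * (exp (- real i * y) * H y))"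
      unfolding pe by (intro Bochner_Integration.integral_sum integrable_mult_right int)
    also have "\<dots> = 0" by (simp only: integral_mult_right_zero zero mult_zero_right sum.neutral_const)
    finally have "(LBINT y. F (exp (- y)) * H y) = (LBINT y. F (exp (- y)) * H y - p (exp (- y)) * H y)"
      by (simp add: Bochner_Integration.integral_diff[OF FH pH])
    also have "\<bar>\<dots>\<bar> \<le> (LBINT y. \<bar>F (exp (- y)) * H y - p (exp (- y)) * H y\<bar>)"
      by (rule integral_abs_bound)
    also have "\<dots> \<le> (LBINT y. e * \<bar>H y\<bar>)"
    proof (rule integral_mono)
      show "integrable lborel (\<lambda>y. \<bar>F (exp (- y)) * H y - p (exp (- y)) * H y\<bar>)"
        using FH pH by auto
      show "integrable lborel (\<lambda>y. e * \<bar>H y\<bar>)" using H by auto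
      fix y
      show "\<bar>F (exp (- y)) * H y - p (exp (- y)) * H y\<bar> \<le> e * \<bar>H y\<bar>"
      proof (cases "y < 0")
        case False
        then have "\<bar>F (exp (- y)) - p (exp (- y))\<bar> \<le> e" by (intro less_imp_le p) auto
        then have "\<bar>F (exp (- y)) - p (exp (- y))\<bar> * \<bar>H y\<bar> \<le> e * \<bar>H y\<bar>"
          by (rule mult_right_mono) simp
        then show ?thesis
          by (simp add: abs_mult[symmetric] left_diff_distrib)
      qed (use H in auto)
    qed
    finally show ?thesis by (simp add: I_def)
  qed
  show ?thesis
  proof (rule ccontr)
    let ?J = "\<bar>LBINT y. F (exp (- y)) * H y\<bar>"
    assume "(LBINT y. F (exp (- y)) * H y) \<noteq> 0"
    then have J: "?J > 0" by simp
    \<comment> \<open>The tolerance \<open>?J / (I + 1)\<close> forces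
      \<open>?J * (I + 1) \<le> ?J * I\<close>; the added 1 covers the case
      \<open>I = 0\<close>.\<close>
    have "?J \<le> ?J / (I + 1) * I" by (rule bound) (use J I in auto)
    then have "?J * (I + 1) \<le> ?J * I" using I by (simp add: field_simps)
    with J show False by (simp add: algebra_simps)
  qed
qed

text \<open>
  The substitution \<open>u = exp (- y)\<close> turns the transform at \<open>\<beta> + n\<close> into an \<open>n\<close>-th moment, and
  the indicator of \<open>{0..<x}\<close> into that of \<open>{exp (- x)<..1}\<close>, a limit of continuous functions of \<open>u\<close>.
\<close>

lemma laplace_transform_eq_0_imp_integral_eq_0:
  fixes h :: "real \<Rightarrow> real"
  assumes int: "\<And>\<beta>. \<beta> > B \<Longrightarrow> set_integrable lborel {0..} (\<lambda>y. exp (- \<beta> * y) * h y)"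
    and zero: "\<And>\<beta>. \<beta> > B \<Longrightarrow> (LBINT y:{0..}. exp (- \<beta> * y) * h y) = 0"
    and x: "x \<ge> 0"
  shows "(LBINT y:{0..x}. h y) = 0"
proof -
  \<comment> \<open>Above \<open>B\<close> the damped function is integrable; positivity makes
    \<open>powr (- \<beta>)\<close> decreasing, which bounds \<open>F\<close> below.\<close>
  define \<beta> where "\<beta> = max B 0 + 1"
  have \<beta>: "\<beta> > B" "\<beta> > 0" by (auto simp: \<beta>_def)
  define H where "H y = indicator {0..} y * (exp (- \<beta> * y) * h y)" for y
  have H_int: "integrable lborel H"
    using int[OF \<beta>(1)] by (simp add: set_integrable_def H_def[abs_def])
  have Hn: "exp (- real n * y) * H y = indicator {0..} y * (exp (- (\<beta> + real n) * y) * h y)" for n y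
    by (simp add: H_def exp_add[symmetric] algebra_simps mult_exp_exp split: split_indicator)
  have H_n_int: "integrable lborel (\<lambda>y. exp (- real n * y) * H y)" for n
    using int[of "\<beta> + real n"] \<beta> unfolding Hn by (simp add: set_integrable_def)
  have H_zero: "(LBINT y. exp (- real n * y) * H y) = 0" for n
    using zero[of "\<beta> + real n"] \<beta> unfolding Hn by (simp add: set_lebesgue_integral_def)
  have [measurable]: "H \<in> borel_measurable borel" using H_int by auto
  \<comment> \<open>At \<open>u = exp (- y)\<close> the first factor equals
    \<open>exp (\<beta> * y)\<close> for \<open>y \<le> x\<close> and so cancels the damping in
    \<open>H\<close>; the cutoff at \<open>exp (- x)\<close> keeps it bounded and continuous. The
    second factor is a ramp increasing to the indicator of \<open>y < x\<close>.\<close>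
  define F where "F n u = max u (exp (- x)) powr (- \<beta>) * min 1 (real n * max 0 (u - exp (- x)))" for n u
  have F_cont: "continuous_on UNIV (F n)" for n
    unfolding F_def by (intro continuous_intros) (auto simp: max_def)
  have [measurable]: "F n \<in> borel_measurable borel" for n
    using F_cont by (rule borel_measurable_continuous_onI)
  have F_lim: "(\<lambda>n. F n (exp (- y)) * H y) \<longlonglongrightarrow> indicator {0..<x} y * h y" for y
  proof (cases "0 \<le> y \<and> y < x")
    case True
    then have d: "exp (- y) - exp (- x) > 0" by simp
    obtain n0 where n0: "1 / (exp (- y) - exp (- x)) < real n0" using reals_Archimedean2 by blast
    have "F n (exp (- y)) * H y = indicator {0..<x} y * h y" if "n \<ge> n0" for n
    proof -
      have "1 \<le> real n0 * (exp (- y) - exp (- x))"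
        using n0 d by (simp add: field_simps)
      also have "\<dots> \<le> real n * (exp (- y) - exp (- x))"
        using that d by (intro mult_right_mono) auto
      finally have "F n (exp (- y)) = exp (- y) powr (- \<beta>)"
        using d by (auto simp: F_def max_def min_def)
      then show ?thesis
        using True by (simp add: H_def powr_def mult.assoc[symmetric] exp_add[symmetric])
    qed
    then show ?thesis
      by (intro tendsto_eventually) (auto simp: eventually_sequentially)
  next
    case False
    then have "F n (exp (- y)) * H y = 0" for n
      by (auto simp: F_def H_def max_def)
    moreover have "indicator {0..<x} y * h y = 0" using False by auto
    ultimately show ?thesis by (simp only: tendsto_const)
  qed
  have "(\<lambda>n. LBINT y. F n (exp (- y)) * H y) \<longlonglongrightarrow> (LBINT y. indicator {0..<x} y * h y)"
  proof (rule integral_dominated_convergence)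
    show "integrable lborel (\<lambda>y. exp (- x) powr (- \<beta>) * \<bar>H y\<bar>)" using H_int by auto
    show "AE y in lborel. (\<lambda>n. F n (exp (- y)) * H y) \<longlonglongrightarrow> indicator {0..<x} y * h y"
      using F_lim by simp
    have "\<bar>F n u\<bar> \<le> exp (- x) powr (- \<beta>)" for n u
    proof -
      have "max u (exp (- x)) powr (- \<beta>) \<le> exp (- x) powr (- \<beta>)"
        using \<beta> by (intro powr_mono2') auto
      moreover have "0 \<le> min 1 (real n * max 0 (u - exp (- x)))" by auto
      ultimately have "F n u \<le> exp (- x) powr (- \<beta>) * 1" "0 \<le> F n u"
        unfolding F_def by (intro mult_mono mult_nonneg_nonneg; simp)+
      then show ?thesis by simp
    qed
    then show "AE y in lborel. norm (F n (exp (- y)) * H y) \<le> exp (- x) powr (- \<beta>) * \<bar>H y\<bar>" for n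
      by (auto simp: abs_mult intro!: mult_right_mono)
    \<comment> \<open>Measurability of \<open>h\<close> on the interval is read off from
      \<open>H\<close> by undoing the damping.\<close>
    have "(\<lambda>y. indicator {0..<x} y * (exp (\<beta> * y) * H y)) \<in> borel_measurable lborel" by measurable
    also have "(\<lambda>y. indicator {0..<x} y * (exp (\<beta> * y) * H y)) = (\<lambda>y. indicator {0..<x} y * h y)"
      by (auto simp: H_def fun_eq_iff mult.assoc[symmetric] exp_add[symmetric] split: split_indicator)
    finally show "(\<lambda>y. indicator {0..<x} y * h y) \<in> borel_measurable lborel" .
  qed measurable
  moreover have "(LBINT y. F n (exp (- y)) * H y) = 0" for n
    by (rule integral_continuous_exp_neg_eq_0[OF H_int _ H_zero H_n_int F_cont]) (auto simp: H_def)
  ultimately have "(LBINT y:{0..<x}. h y) = 0"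
    by (simp add: LIMSEQ_const_iff set_lebesgue_integral_def)
  \<comment> \<open>The ramp vanishes at \<open>y = x\<close>, so the limit sees the half-open
    interval; the endpoint is a null set.\<close>
  moreover have "(LBINT y:{0..x}. h y) = (LBINT y:{0..<x}. h y)"
  proof (rule set_integral_cong_set)
    have "set_borel_measurable lborel {0..} h"
    proof -
      have "(\<lambda>y. exp (\<beta> * y) * H y) \<in> borel_measurable lborel" by measurable
      also have "(\<lambda>y. exp (\<beta> * y) * H y) = (\<lambda>y. indicator {0..} y *\<^sub>R h y)"
        by (auto simp: H_def fun_eq_iff mult.assoc[symmetric] exp_add[symmetric] split: split_indicator)
      finally show ?thesis by (simp add: set_borel_measurable_def)
    qed
    then show "set_borel_measurable lborel {0..<x} h" "set_borel_measurable lborel {0..x} h"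
      by (auto intro: set_borel_measurable_subset)
    show "AE y in lborel. (y \<in> {0..<x}) = (y \<in> {0..x})"
      using AE_lborel_singleton[of x] by eventually_elim auto
  qed
  ultimately show ?thesis by simp
qed

section \<open>The Laplace exponent\<close>

context negative_compound_poisson
begin

lemma AE_\<nu>_nonneg: "AE s in \<nu>. 0 \<le> s"
proof -
  have "{..0} \<in> null_sets \<nu>"
    using \<nu>_positive \<nu>_sets by (intro null_setsI) auto
  from AE_not_in[OF this] show ?thesis by eventually_elim simp
qed

lemma \<xi>_measurable: "i \<ge> 1 \<Longrightarrow> \<xi> i \<in> borel_measurable M"
  using \<xi>_indep by (simp add: indep_vars_def)

lemma AE_\<xi>_nonneg:
  assumes "i \<ge> 1"
  shows "AE \<omega> in M. 0 \<le> \<xi> i \<omega>"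
proof (rule AE_distrD[OF \<xi>_measurable[OF assms]])
  show "AE s in distr M borel (\<xi> i). 0 \<le> s"
    unfolding \<xi>_distr[OF assms] by (rule AE_\<nu>_nonneg)
qed

text \<open>The Poisson law is given for the \<open>int\<close>-valued increment from time 0. As
  \<open>N 0\<close> vanishes almost surely, the two events differ by a null set.\<close>

lemma prob_N_1: "prob {\<omega> \<in> space M. N 1 \<omega> = n} = rate ^ n / fact n * exp (- rate)"
proof -
  have [measurable]: "N 1 \<in> measurable M (count_space UNIV)" "N 0 \<in> measurable M (count_space UNIV)"
    by (intro N_measurable; simp)+
  have "prob {\<omega> \<in> space M. N 1 \<omega> = n} = prob {\<omega> \<in> space M. int (N 1 \<omega>) - int (N 0 \<omega>) = int n}"
  proof (rule finite_measure_eq_AE)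
    show "AE \<omega> in M. (\<omega> \<in> {\<omega> \<in> space M. N 1 \<omega> = n}) =
        (\<omega> \<in> {\<omega> \<in> space M. int (N 1 \<omega>) - int (N 0 \<omega>) = int n})"
      using N_zero by eventually_elim simp
  qed measurable
  also have "{\<omega> \<in> space M. int (N 1 \<omega>) - int (N 0 \<omega>) = int n} =
      (\<lambda>\<omega>. int (N 1 \<omega>) - int (N 0 \<omega>)) -` {int n} \<inter> space M"
    by auto
  also have "prob \<dots> = measure (distr M (count_space UNIV) (\<lambda>\<omega>. int (N 1 \<omega>) - int (N 0 \<omega>))) {int n}"
    by (rule measure_distr [symmetric]) measurable
  also have "\<dots> = pmf (map_pmf int (poisson_pmf rate)) (int n)"
    using N_increments_poisson[of 0 1] by (simp add: measure_pmf_single)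
  also have "\<dots> = pmf (poisson_pmf rate) n"
    by (rule pmf_map_inj') (simp add: inj_def)
  finally show ?thesis using rate_pos by simp
qed

lemma expectation_prod_exp:
  assumes u: "0 \<le> u"
  shows "integrable M (\<lambda>\<omega>. \<Prod>i=1..n. exp (- u * \<xi> i \<omega>))"
    and "expectation (\<lambda>\<omega>. \<Prod>i=1..n. exp (- u * \<xi> i \<omega>)) = (LINT s|\<nu>. exp (- u * s)) ^ n"
proof -
  have int: "integrable M (\<lambda>\<omega>. exp (- u * \<xi> i \<omega>))" if "i \<in> {1..n}" for i
  proof (rule integrable_const_bound)
    show "AE \<omega> in M. norm (exp (- u * \<xi> i \<omega>)) \<le> 1"
      using AE_\<xi>_nonneg[of i] that u by (auto intro: AE_mp)
    show "(\<lambda>\<omega>. exp (- u * \<xi> i \<omega>)) \<in> borel_measurable M"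
      using \<xi>_measurable[of i] that by simp
  qed
  have single: "expectation (\<lambda>\<omega>. exp (- u * \<xi> i \<omega>)) = (LINT s|\<nu>. exp (- u * s))" if "i \<in> {1..n}" for i
    using integral_distr[OF \<xi>_measurable[of i], of "\<lambda>s. exp (- u * s)"] \<xi>_distr[of i] that by simp
  have "indep_vars (\<lambda>_. borel) \<xi> {1..n}"
    using \<xi>_indep by (rule indep_vars_subset) auto
  then have indep: "indep_vars (\<lambda>_. borel) (\<lambda>i \<omega>. exp (- u * \<xi> i \<omega>)) {1..n}"
    by (rule indep_vars_compose2[where Y = "\<lambda>_ s. exp (- u * s)"]) simp
  show "integrable M (\<lambda>\<omega>. \<Prod>i=1..n. exp (- u * \<xi> i \<omega>))"
    using indep int by (intro indep_vars_integrable) auto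
  have "expectation (\<lambda>\<omega>. \<Prod>i=1..n. exp (- u * \<xi> i \<omega>)) = (\<Prod>i=1..n. expectation (\<lambda>\<omega>. exp (- u * \<xi> i \<omega>)))"
    using indep int by (intro indep_vars_lebesgue_integral) auto
  also have "\<dots> = (\<Prod>i=1..n. (LINT s|\<nu>. exp (- u * s)))"
    by (intro prod.cong single refl)
  finally show "expectation (\<lambda>\<omega>. \<Prod>i=1..n. exp (- u * \<xi> i \<omega>)) = (LINT s|\<nu>. exp (- u * s)) ^ n"
    by simp
qed

text \<open>
  In the assumption \<open>N_indep_\<xi>\<close> both components are functions from \<^typ>\<open>nat\<close> to \<^typ>\<open>real\<close>, and
  coercions turn the first one into the values of the process at integer times. Time \<open>1\<close> is among them.
\<close>

lemma expectation_exp_cpp_1: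
  assumes u: "0 \<le> u"
  shows "expectation (\<lambda>\<omega>. exp (u * cpp c N \<xi> 1 \<omega>)) =
    exp (u * c + rate * ((LINT s|\<nu>. exp (- u * s)) - 1))"
proof -
  define h where "h = (LINT s|\<nu>. exp (- u * s))"
  have h: "0 \<le> h" by (simp add: h_def)
  define Z where "Z n \<omega> = (\<Prod>i=1..n. exp (- u * \<xi> i \<omega>))" for n \<omega>
  have Z_nonneg: "0 \<le> Z n \<omega>" for n \<omega> by (auto simp: Z_def intro: prod_nonneg)
  have N1[measurable]: "N 1 \<in> measurable M (count_space UNIV)" by (rule N_measurable) simp
  \<comment> \<open>Splitting over the value of \<open>N 1\<close> replaces the random number of
    factors by a fixed one, so that independence applies to each \<open>f n\<close>.\<close>
  define f where "f n \<omega> = indicator {n} (N 1 \<omega>) * Z n \<omega>" for n \<omega>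
  have f: "integrable M (f n)" "expectation (f n) = rate ^ n / fact n * exp (- rate) * h ^ n" for n
  proof -
    have "(\<lambda>f. indicator {real n} (f (1 :: nat)) :: real) \<in> borel_measurable (PiM {0..} (\<lambda>_. count_space UNIV))"
      by (rule measurable_compose[OF measurable_component_singleton]) auto
    moreover have "(\<lambda>f. \<Prod>i=1..n. exp (- u * f i)) \<in> borel_measurable (PiM {1..} (\<lambda>_. borel))"
      by (intro borel_measurable_prod borel_measurable_exp[THEN measurable_compose_rev]
          borel_measurable_times borel_measurable_const measurable_component_singleton) auto
    ultimately have "indep_var borel ((\<lambda>f. indicator {real n} (f (1 :: nat)) :: real) \<circ> (\<lambda>\<omega> k. real ((\<lambda>t\<in>{0..}. N t \<omega>) (real k))))
        borel ((\<lambda>f. \<Prod>i=1..n. exp (- u * f i)) \<circ> (\<lambda>\<omega>. \<lambda>i\<in>{1..}. \<xi> i \<omega>))"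
      by (rule indep_var_compose[OF N_indep_\<xi>])
    also have "((\<lambda>f. indicator {real n} (f (1 :: nat)) :: real) \<circ> (\<lambda>\<omega> k. real ((\<lambda>t\<in>{0..}. N t \<omega>) (real k)))) = (\<lambda>\<omega>. indicator {n} (N 1 \<omega>))"
      by (auto simp: fun_eq_iff split: split_indicator)
    also have "((\<lambda>f. \<Prod>i=1..n. exp (- u * f i)) \<circ> (\<lambda>\<omega>. \<lambda>i\<in>{1..}. \<xi> i \<omega>)) = Z n"
      by (simp add: fun_eq_iff Z_def)
    finally have indep: "indep_var borel (\<lambda>\<omega>. indicator {n} (N 1 \<omega>) :: real) borel (Z n)" .
    have Z: "integrable M (Z n)" "expectation (Z n) = h ^ n"
      using expectation_prod_exp[OF u, of n] by (simp_all add: Z_def[abs_def] h_def)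
    have ind_eq: "(\<lambda>\<omega>. indicator {n} (N 1 \<omega>) :: real) = indicator {\<omega>. N 1 \<omega> = n}"
      by (auto simp: fun_eq_iff split: split_indicator)
    have ind: "integrable M (\<lambda>\<omega>. indicator {n} (N 1 \<omega>) :: real)"
      by (rule integrable_const_bound[where B = 1, OF _ indep_var_rv1[OF indep]])
         (auto split: split_indicator)
    have "expectation (\<lambda>\<omega>. indicator {n} (N 1 \<omega>)) = prob {\<omega> \<in> space M. N 1 \<omega> = n}"
      unfolding ind_eq by (simp add: Int_def conj_commute)
    then have ind_exp: "expectation (\<lambda>\<omega>. indicator {n} (N 1 \<omega>)) = rate ^ n / fact n * exp (- rate)"
      by (simp only: prob_N_1)
    show "integrable M (f n)"
      unfolding f_def[abs_def] by (rule indep_var_integrable[OF indep ind Z(1)])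
    show "expectation (f n) = rate ^ n / fact n * exp (- rate) * h ^ n"
      unfolding f_def[abs_def] using indep_var_lebesgue_integral[OF indep ind Z(1)] ind_exp Z(2) by simp
  qed
  have "(\<lambda>n. (rate * h) ^ n /\<^sub>R fact n * exp (- rate)) sums (exp (rate * h) * exp (- rate))"
    by (intro sums_mult2 exp_converges)
  then have f_sums: "(\<lambda>n. expectation (f n)) sums (exp (rate * h) * exp (- rate))"
    by (simp add: f power_mult_distrib field_simps)
  \<comment> \<open>For each outcome a single summand survives, so pointwise summability is
    immediate.\<close>
  have f_pt: "f n \<omega> = 0" if "n \<notin> {N 1 \<omega>}" for n \<omega>
    using that by (auto simp: f_def)
  have suminf_f: "(\<Sum>n. f n \<omega>) = Z (N 1 \<omega>) \<omega>" for \<omega>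
    using suminf_finite[of "{N 1 \<omega>}" "\<lambda>n. f n \<omega>"] f_pt by (simp add: f_def)
  have "(\<lambda>n. expectation (f n)) sums expectation (\<lambda>\<omega>. \<Sum>n. f n \<omega>)"
  proof (rule sums_integral)
    show "AE \<omega> in M. summable (\<lambda>n. norm (f n \<omega>))"
      using f_pt by (intro AE_I2 summable_finite[of "{N 1 _}"]) auto
    have "norm (f n \<omega>) = f n \<omega>" for n \<omega>
      using Z_nonneg by (simp add: f_def)
    then show "summable (\<lambda>n. expectation (\<lambda>\<omega>. norm (f n \<omega>)))"
      using f_sums by (simp add: sums_iff)
  qed (rule f)
  then have "expectation (\<lambda>\<omega>. Z (N 1 \<omega>) \<omega>) = exp (rate * h) * exp (- rate)"
    using sums_unique2[OF f_sums] by (simp add: suminf_f)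
  moreover have "exp (u * cpp c N \<xi> 1 \<omega>) = exp (u * c) * Z (N 1 \<omega>) \<omega>" for \<omega>
    by (simp add: cpp_def Z_def exp_sum[symmetric] exp_add[symmetric] sum_negf sum_distrib_left right_diff_distrib)
  ultimately show ?thesis
    unfolding h_def[symmetric] by (simp add: exp_add[symmetric] algebra_simps)
qed

lemma laplace_exponent_cpp:
  assumes "0 \<le> u"
  shows "laplace_exponent M (cpp c N \<xi>) u = c * u + rate * ((LINT s|\<nu>. exp (- u * s)) - 1)"
  using expectation_exp_cpp_1[OF assms] by (simp add: laplace_exponent_def mult.commute)

end

section \<open>The series\<close>

text \<open>Cutting \<open>g\<close> off outside the triangle \<open>0 \<le> s \<le> y\<close> lets
  all integrals run over the whole line, so Fubini meets no variable limits.\<close>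

definition scale_kernel :: "real \<Rightarrow> real \<Rightarrow> real \<Rightarrow> nat \<Rightarrow> real \<Rightarrow> real \<Rightarrow> real" where
  "scale_kernel c rate q k s y = indicator {0..y} s * g c rate q k s y"

lemma measurable_scale_kernel [measurable]:
  "(\<lambda>(s, y). scale_kernel c rate q k s y) \<in> borel_measurable (borel \<Otimes>\<^sub>M borel)"
proof -
  have "(\<lambda>(s, y). scale_kernel c rate q k s y) =
      (\<lambda>(s, y). if 0 \<le> s \<and> s \<le> y then g c rate q k s y else 0)"
    by (auto simp: scale_kernel_def fun_eq_iff)
  also have "\<dots> \<in> borel_measurable (borel \<Otimes>\<^sub>M borel)"
    unfolding g_def by measurable
  finally show ?thesis .
qed

text \<open>For \<open>y \<ge> 0\<close> and positive \<open>c\<close> and \<open>rate\<close> this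
  is the absolute value of \<open>g\<close> at \<open>s = 0\<close>, a majorant uniform in
  \<open>s\<close>.\<close>

definition scale_kernel_bound :: "real \<Rightarrow> real \<Rightarrow> real \<Rightarrow> nat \<Rightarrow> real \<Rightarrow> real" where
  "scale_kernel_bound c rate q k y = indicator {0..} y * (exp ((q + rate) / c * y) * ((rate / c * y) ^ k / fact k))"

lemma measurable_scale_kernel_bound [measurable]:
  "scale_kernel_bound c rate q k \<in> borel_measurable borel"
  unfolding scale_kernel_bound_def by measurable

locale scale_parameters =
  fixes c rate q :: real
  assumes c_pos: "0 < c" and rate_pos: "0 < rate" and q_nonneg: "0 \<le> q"
begin

abbreviation "K \<equiv> scale_kernel c rate q"
abbreviation "G \<equiv> scale_kernel_bound c rate q"
abbreviation "growth \<equiv> (q + rate) / c + rate / c"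

lemma G_nonneg: "0 \<le> G k y"
  using c_pos rate_pos by (auto simp: scale_kernel_bound_def split: split_indicator)

lemma G_sums: "(\<lambda>k. G k y) sums (indicator {0..} y * exp (growth * y))"
proof -
  have "(\<lambda>k. (rate / c * y) ^ k / fact k) sums exp (rate / c * y)"
    using exp_converges[of "rate / c * y"] by (simp add: divide_inverse mult.commute)
  then show ?thesis
    unfolding scale_kernel_bound_def distrib_right exp_add by (intro sums_mult)
qed

text \<open>On the triangle the absolute value depends on \<open>y - s\<close> through an
  exponential and a power, both increasing, and \<open>y - s \<le> y\<close>.\<close>

lemma abs_K_le: "\<bar>K k s y\<bar> \<le> G k y"
proof (cases "0 \<le> s \<and> s \<le> y")
  case True
  have "\<bar>K k s y\<bar> = exp ((q + rate) / c * (y - s)) * ((rate / c * (y - s)) ^ k / fact k)"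
  proof -
    have "- ((q + rate) / c) * (s - y) = (q + rate) / c * (y - s)"
      using c_pos by (simp add: field_simps)
    moreover have "\<bar>s - y\<bar> = y - s" using True by simp
    ultimately show ?thesis
      using True c_pos rate_pos
      by (simp add: scale_kernel_def g_def abs_mult power_abs power_mult_distrib power_divide)
  qed
  also have "\<dots> \<le> exp ((q + rate) / c * y) * ((rate / c * y) ^ k / fact k)"
  proof -
    have le: "(q + rate) / c * (y - s) \<le> (q + rate) / c * y" "rate / c * (y - s) \<le> rate / c * y"
      using True c_pos rate_pos q_nonneg by (intro mult_left_mono; simp)+
    have nonneg: "0 \<le> rate / c * (y - s)"
      using True c_pos rate_pos by simp
    have "(rate / c * (y - s)) ^ k / fact k \<le> (rate / c * y) ^ k / fact k"
      using le(2) nonneg by (rule divide_right_mono[OF power_mono]) simp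
    moreover have "0 \<le> (rate / c * (y - s)) ^ k / fact k"
      using zero_le_power[OF nonneg, of k] by (rule divide_nonneg_nonneg) simp
    ultimately show ?thesis
      using le(1) by (intro mult_mono) (simp_all only: exp_le_cancel_iff exp_ge_zero)
  qed
  finally show ?thesis using True by (simp add: scale_kernel_bound_def)
next
  case False
  then have "K k s y = 0" by (simp add: scale_kernel_def)
  with G_nonneg show ?thesis by simp
qed

end

section \<open>Termwise integration of the series\<close>

text \<open>The family \<open>\<mu>\<close> stands for the convolution powers. Exchanging sums and
  integrals relies on total mass 1; the convolution structure enters only through the Laplace
  transforms.\<close>

locale scale_measures = scale_parameters +
  fixes \<mu> :: "nat \<Rightarrow> real measure"
  assumes prob_space_\<mu>: "prob_space (\<mu> k)"
    and sets_\<mu> [measurable_cong]: "sets (\<mu> k) = sets borel"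
begin

definition w :: "nat \<Rightarrow> real \<Rightarrow> real" where
  "w k y = (LINT s|\<mu> k. K k s y)"

text \<open>The candidate for \<open>c\<close> times the scale function.\<close>

definition S :: "real \<Rightarrow> real" where
  "S y = (\<Sum>k. w k y)"

lemma measurable_w [measurable]: "w k \<in> borel_measurable borel"
proof -
  interpret prob_space "\<mu> k" by (rule prob_space_\<mu>)
  show ?thesis unfolding w_def by measurable
qed

lemma abs_w_le: "\<bar>w k y\<bar> \<le> G k y"
proof -
  interpret prob_space "\<mu> k" by (rule prob_space_\<mu>)
  have int: "integrable (\<mu> k) (\<lambda>s. K k s y)"
    by (rule integrable_const_bound[where B = "G k y"]) (auto simp: abs_K_le)
  have "\<bar>w k y\<bar> \<le> (LINT s|\<mu> k. \<bar>K k s y\<bar>)"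
    unfolding w_def by (rule integral_abs_bound)
  also have "\<dots> \<le> (LINT s|\<mu> k. G k y)"
    using int by (intro integral_mono) (auto simp: abs_K_le)
  also have "\<dots> = G k y" by (simp add: prob_space)
  finally show ?thesis .
qed

lemma summable_abs_w: "summable (\<lambda>k. \<bar>w k y\<bar>)"
  using sums_summable[OF G_sums] by (rule summable_comparison_test'[where N = 0]) (simp, rule abs_w_le)

lemma S_eq_0: "y < 0 \<Longrightarrow> S y = 0"
  by (simp add: S_def w_def scale_kernel_def)

text \<open>One domination argument serves two weights: the indicator of \<open>{0..x}\<close>
  yields the primitive, and \<open>exp (- \<beta> * y)\<close> yields the Laplace transform. The sum
  of the bounds \<open>G\<close> times the weight is an integrable majorant.\<close>

lemma
  fixes \<phi> :: "real \<Rightarrow> real"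
  assumes [measurable]: "\<phi> \<in> borel_measurable borel" and \<phi>_nonneg: "\<And>y. 0 \<le> \<phi> y"
    and int: "integrable lborel (\<lambda>y. \<phi> y * (indicator {0..} y * exp (growth * y)))"
  shows integrable_weighted_S: "integrable lborel (\<lambda>y. \<phi> y * S y)"
    and weighted_S_sums:
      "(\<lambda>k. LINT s|\<mu> k. (LBINT y. \<phi> y * K k s y)) sums (LBINT y. \<phi> y * S y)"
proof -
  have G_le: "\<phi> y * G k y \<le> \<phi> y * (indicator {0..} y * exp (growth * y))" for k y
    using sum_le_suminf[OF sums_summable[OF G_sums], of "{k}" y] G_nonneg \<phi>_nonneg
    by (intro mult_left_mono) (auto simp: sums_unique[OF G_sums])
  have \<phi>G: "integrable lborel (\<lambda>y. \<phi> y * G k y)" for k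
    using int
  proof (rule Bochner_Integration.integrable_bound)
    show "AE y in lborel. norm (\<phi> y * G k y) \<le> norm (\<phi> y * (indicator {0..} y * exp (growth * y)))"
      using G_le \<phi>_nonneg G_nonneg by (intro AE_I2) (auto simp: abs_mult)
  qed measurable
  have fubini: "integrable lborel (\<lambda>y. \<phi> y * w k y)"
      "(LBINT y. \<phi> y * w k y) = (LINT s|\<mu> k. (LBINT y. \<phi> y * K k s y))" for k
  proof -
    interpret prob_space "\<mu> k" by (rule prob_space_\<mu>)
    interpret P: pair_sigma_finite "\<mu> k" lborel ..
    \<comment> \<open>The bound \<open>G\<close> is independent of \<open>s\<close>, so it stays
      integrable on the product with a probability measure.\<close>
    have "integrable (\<mu> k \<Otimes>\<^sub>M lborel) (\<lambda>p. \<phi> (snd p) * G k (snd p))"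
      by (rule P.Fubini_integrable) (use \<phi>G in auto)
    then have "integrable (\<mu> k \<Otimes>\<^sub>M lborel) (\<lambda>(s, y). \<phi> y * K k s y)"
    proof (rule Bochner_Integration.integrable_bound)
      show "AE p in \<mu> k \<Otimes>\<^sub>M lborel. norm (case p of (s, y) \<Rightarrow> \<phi> y * K k s y) \<le> norm (\<phi> (snd p) * G k (snd p))"
        using abs_K_le \<phi>_nonneg G_nonneg by (intro AE_I2) (auto simp: abs_mult intro!: mult_left_mono)
    qed measurable
    from P.integrable_snd[OF this] P.Fubini_integral[OF this]
    show "integrable lborel (\<lambda>y. \<phi> y * w k y)"
      "(LBINT y. \<phi> y * w k y) = (LINT s|\<mu> k. (LBINT y. \<phi> y * K k s y))"
      by (simp_all add: w_def)
  qed
  have norm_w: "norm (\<phi> y * w k y) \<le> \<phi> y * G k y" for k y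
    using abs_w_le \<phi>_nonneg by (auto simp: abs_mult intro!: mult_left_mono)
  \<comment> \<open>Partial sums of the norms are bounded by the integral of the full majorant,
    which licenses exchanging series and integral.\<close>
  have "summable (\<lambda>k. LBINT y. norm (\<phi> y * w k y))"
  proof (rule summableI_nonneg_bounded)
    fix n
    have "(\<Sum>k<n. LBINT y. norm (\<phi> y * w k y)) = (LBINT y. (\<Sum>k<n. norm (\<phi> y * w k y)))"
      by (intro Bochner_Integration.integral_sum[symmetric] integrable_norm fubini)
    also have "\<dots> \<le> (LBINT y. \<phi> y * (indicator {0..} y * exp (growth * y)))"
    proof (intro integral_mono int Bochner_Integration.integrable_sum integrable_norm fubini)
      fix y
      have "(\<Sum>k<n. norm (\<phi> y * w k y)) \<le> (\<Sum>k<n. \<phi> y * G k y)"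
        by (intro sum_mono norm_w)
      also have "\<dots> = \<phi> y * (\<Sum>k<n. G k y)" by (simp add: sum_distrib_left)
      also have "\<dots> \<le> \<phi> y * (\<Sum>k. G k y)"
        by (intro mult_left_mono sum_le_suminf sums_summable[OF G_sums] G_nonneg \<phi>_nonneg) auto
      finally show "(\<Sum>k<n. norm (\<phi> y * w k y)) \<le> \<phi> y * (indicator {0..} y * exp (growth * y))"
        by (simp only: sums_unique[OF G_sums, symmetric])
    qed
    finally show "(\<Sum>k<n. LBINT y. norm (\<phi> y * w k y)) \<le> (LBINT y. \<phi> y * (indicator {0..} y * exp (growth * y)))" .
  qed simp
  moreover have "AE y in lborel. summable (\<lambda>k. norm (\<phi> y * w k y))"
    using summable_abs_w \<phi>_nonneg by (simp add: abs_mult summable_mult)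
  moreover have S_eq: "(\<lambda>y. \<phi> y * S y) = (\<lambda>y. \<Sum>k. \<phi> y * w k y)"
    unfolding S_def using summable_rabs_cancel[OF summable_abs_w] by (simp add: suminf_mult)
  ultimately show "integrable lborel (\<lambda>y. \<phi> y * S y)"
    "(\<lambda>k. LINT s|\<mu> k. (LBINT y. \<phi> y * K k s y)) sums (LBINT y. \<phi> y * S y)"
    unfolding S_eq fubini(2)[symmetric]
    by (intro integrable_suminf sums_integral fubini; simp)+
qed

lemma
  assumes x: "0 \<le> x"
  shows set_integrable_S: "set_integrable lborel {0..x} S"
    and primitive_S_sums:
      "(\<lambda>k. LINT s:{0..<x}|\<mu> k. (LBINT y:{s..x}. g c rate q k s y)) sums (LBINT y:{0..x}. S y)"
proof -
  have "set_integrable lborel {0..x} (\<lambda>y. exp (growth * y))"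
    by (intro borel_integrable_atLeastAtMost' continuous_intros)
  then have int: "integrable lborel (\<lambda>y. indicator {0..x} y * (indicator {0..} y * exp (growth * y)))"
    unfolding set_integrable_def
    by (rule Bochner_Integration.integrable_cong[THEN iffD1, rotated -1]) (auto split: split_indicator)
  show "set_integrable lborel {0..x} S"
    using integrable_weighted_S[OF _ _ int] by (simp add: set_integrable_def)
  \<comment> \<open>At \<open>s = x\<close> the left integrand lives on the single point
    \<open>y = x\<close>, which is null; this is why \<open>s\<close> may range over the half-open
    interval.\<close>
  have inner: "(LBINT y. indicator {0..x} y * K k s y) =
      indicator {0..<x} s * (LBINT y:{s..x}. g c rate q k s y)" for k s
  proof (cases "s = x")
    case True
    have "AE y in lborel. indicator {0..x} y * K k s y = 0"
      using AE_lborel_singleton[of x]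
      by eventually_elim (auto simp: True scale_kernel_def split: split_indicator)
    then show ?thesis using True by (simp add: integral_eq_zero_AE)
  next
    case False
    then show ?thesis
      unfolding set_lebesgue_integral_def integral_mult_right_zero[symmetric]
      by (intro Bochner_Integration.integral_cong) (auto simp: scale_kernel_def split: split_indicator)
  qed
  show "(\<lambda>k. LINT s:{0..<x}|\<mu> k. (LBINT y:{s..x}. g c rate q k s y)) sums (LBINT y:{0..x}. S y)"
  proof -
    have "(LINT s:{0..<x}|\<mu> k. (LBINT y:{s..x}. g c rate q k s y)) =
        (LINT s|\<mu> k. (LBINT y. indicator {0..x} y * K k s y))" for k
      unfolding inner by (simp only: set_lebesgue_integral_def real_scaleR_def)
    moreover have "(LBINT y:{0..x}. S y) = (LBINT y. indicator {0..x} y * S y)"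
      by (simp only: set_lebesgue_integral_def real_scaleR_def)
    moreover have "(\<lambda>k. LINT s|\<mu> k. (LBINT y. indicator {0..x} y * K k s y)) sums (LBINT y. indicator {0..x} y * S y)"
      by (rule weighted_S_sums[OF _ _ int]) auto
    ultimately show ?thesis by (simp only:)
  qed
qed

section \<open>Laplace transform of the series\<close>

text \<open>After the shift \<open>y = s + t\<close> the integrand is a constant multiple of the
  Erlang density of order \<open>k\<close> and rate \<open>\<beta> - (q + rate) / c\<close>. The
  sign comes from \<open>(s - y) ^ k = (- t) ^ k\<close>.\<close>

lemma LBINT_exp_kernel:
  assumes \<beta>: "(q + rate) / c < \<beta>" and s: "0 \<le> s"
  shows "(LBINT y. exp (- \<beta> * y) * K k s y) =
    exp (- \<beta> * s) * ((- (rate / c)) ^ k / (\<beta> - (q + rate) / c) ^ Suc k)"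
proof -
  define \<gamma> where "\<gamma> = \<beta> - (q + rate) / c"
  have \<gamma>: "0 < \<gamma>" using \<beta> by (simp add: \<gamma>_def)
  define C where "C = exp (- \<beta> * s) * ((- (rate / c)) ^ k / \<gamma> ^ Suc k)"
  have "(LBINT y. exp (- \<beta> * y) * K k s y) = (LBINT t. exp (- \<beta> * (s + t)) * K k s (s + t))"
    using lborel_integral_real_affine[of 1 "\<lambda>y. exp (- \<beta> * y) * K k s y" s] by simp
  also have "\<dots> = (LBINT t. C * erlang_density k \<gamma> t)"
  proof (intro Bochner_Integration.integral_cong refl)
    fix t
    show "exp (- \<beta> * (s + t)) * K k s (s + t) = C * erlang_density k \<gamma> t"
    proof (cases "t < 0")
      case False
      have "exp (- \<beta> * (s + t)) * exp (- ((q + rate) / c) * (s - (s + t))) = exp (- \<beta> * s) * exp (- \<gamma> * t)"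
        unfolding exp_add[symmetric] \<gamma>_def using c_pos by (simp add: field_simps)
      moreover have "(s - (s + t)) ^ k = (- 1) ^ k * t ^ k"
        by (simp add: power_minus[of t])
      moreover have "(- (rate / c)) ^ k = (- 1) ^ k * (rate / c) ^ k"
        by (rule power_minus)
      ultimately show ?thesis
        using False s \<gamma>
        by (simp add: scale_kernel_def g_def erlang_density_def C_def)
    qed (use s in \<open>simp add: scale_kernel_def erlang_density_def\<close>)
  qed
  also have "(LBINT t. C * erlang_density k \<gamma> t) = C * (LBINT t. erlang_density k \<gamma> t)"
    by simp
  \<comment> \<open>The zeroth moment of the Erlang density is its total mass.\<close>
  also have "(LBINT t. erlang_density k \<gamma> t) = 1"
    using nn_integral_erlang_ith_moment[OF \<gamma>, of k 0] \<gamma>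
    by (subst integral_eq_nn_integral) auto
  finally show ?thesis by (simp add: C_def \<gamma>_def)
qed

text \<open>Up to a constant this is the exponential density of rate
  \<open>\<beta> - growth\<close>, the Erlang density of order 0.\<close>

lemma integrable_exp_growth:
  assumes "growth < \<beta>"
  shows "integrable lborel (\<lambda>y. exp (- \<beta> * y) * (indicator {0..} y * exp (growth * y)))"
proof -
  define \<delta> where "\<delta> = \<beta> - growth"
  have \<delta>: "0 < \<delta>" using assms by (simp add: \<delta>_def)
  have "integrable lborel (erlang_density 0 \<delta>)"
    using nn_integral_erlang_ith_moment[OF \<delta>, of 0 0] \<delta>
    by (intro integrableI_nonneg) auto
  then have "integrable lborel (\<lambda>y. erlang_density 0 \<delta> y / \<delta>)" by simp
  also have "(\<lambda>y. erlang_density 0 \<delta> y / \<delta>) = (\<lambda>y. exp (- \<beta> * y) * (indicator {0..} y * exp (growth * y)))"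
  proof
    fix y
    have "exp (- \<beta> * y) * exp (growth * y) = exp (- \<delta> * y)"
      unfolding exp_add[symmetric] \<delta>_def by (simp add: algebra_simps)
    then show "erlang_density 0 \<delta> y / \<delta> = exp (- \<beta> * y) * (indicator {0..} y * exp (growth * y))"
      using \<delta> by (auto simp: erlang_density_def split: split_indicator)
  qed
  finally show ?thesis .
qed

text \<open>Integrating the Erlang transforms over \<open>s\<close> leaves a geometric series of
  ratio \<open>- (rate / c * h / \<gamma>)\<close>. The condition \<open>growth < \<beta>\<close>
  says \<open>rate / c < \<gamma>\<close>, so with \<open>h \<le> 1\<close> the ratio has modulus
  below 1.\<close>

lemma
  assumes \<beta>: "growth < \<beta>"
    and pos: "\<And>k. AE s in \<mu> k. 0 \<le> s"
    and laplace: "\<And>k. (LINT s|\<mu> k. exp (- \<beta> * s)) = h ^ k"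
    and h: "0 \<le> h" "h \<le> 1"
  shows integrable_exp_S: "integrable lborel (\<lambda>y. exp (- \<beta> * y) * S y)"
    and laplace_transform_S: "(LBINT y. exp (- \<beta> * y) * S y) = c / (c * \<beta> + rate * (h - 1) - q)"
proof -
  show "integrable lborel (\<lambda>y. exp (- \<beta> * y) * S y)"
    by (rule integrable_weighted_S[OF _ _ integrable_exp_growth[OF \<beta>]]) auto
  define \<gamma> where "\<gamma> = \<beta> - (q + rate) / c"
  have \<gamma>: "rate / c < \<gamma>" using \<beta> by (simp add: \<gamma>_def)
  have "0 < rate / c" using c_pos rate_pos by simp
  with \<gamma> have \<gamma>_pos: "0 < \<gamma>" by linarith
  have "(LINT s|\<mu> k. (LBINT y. exp (- \<beta> * y) * K k s y)) = 1 / \<gamma> * (- (rate / c * h / \<gamma>)) ^ k" for k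
  proof -
    interpret prob_space "\<mu> k" by (rule prob_space_\<mu>)
    have "(LINT s|\<mu> k. (LBINT y. exp (- \<beta> * y) * K k s y)) =
        (LINT s|\<mu> k. exp (- \<beta> * s) * ((- (rate / c)) ^ k / \<gamma> ^ Suc k))"
    proof (rule integral_cong_AE)
      show "AE s in \<mu> k. (LBINT y. exp (- \<beta> * y) * K k s y) = exp (- \<beta> * s) * ((- (rate / c)) ^ k / \<gamma> ^ Suc k)"
        using pos[of k] by eventually_elim (use LBINT_exp_kernel \<gamma>_pos in \<open>simp add: \<gamma>_def\<close>)
    qed measurable
    also have "\<dots> = h ^ k * ((- (rate / c)) ^ k / \<gamma> ^ Suc k)"
      by (simp only: integral_mult_left_zero laplace)
    also have "\<dots> = 1 / \<gamma> * (- (rate / c * h / \<gamma>)) ^ k"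
      using \<gamma>_pos by (simp add: power_mult_distrib power_divide power_minus[of "_ / _"] ac_simps)
    finally show ?thesis .
  qed
  with weighted_S_sums[OF _ _ integrable_exp_growth[OF \<beta>]]
  have "(\<lambda>k. 1 / \<gamma> * (- (rate / c * h / \<gamma>)) ^ k) sums (LBINT y. exp (- \<beta> * y) * S y)"
    by simp
  moreover have "(\<lambda>k. 1 / \<gamma> * (- (rate / c * h / \<gamma>)) ^ k) sums (1 / \<gamma> * (1 / (1 - (- (rate / c * h / \<gamma>)))))"
  proof (intro sums_mult geometric_sums)
    have "rate / c * h \<le> rate / c" using mult_left_mono[of h 1 "rate / c"] h \<open>0 < rate / c\<close> by simp
    also have "\<dots> < \<gamma>" by (rule \<gamma>)
    finally have "rate / c * h / \<gamma> < 1" using \<gamma>_pos by (subst divide_less_eq_1_pos)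
    moreover have "0 \<le> rate / c * h / \<gamma>" using \<gamma>_pos h c_pos rate_pos by simp
    ultimately show "norm (- (rate / c * h / \<gamma>)) < 1"
      by (simp only: norm_minus_cancel real_norm_def abs_of_nonneg)
  qed
  ultimately have "(LBINT y. exp (- \<beta> * y) * S y) = 1 / \<gamma> * (1 / (1 - (- (rate / c * h / \<gamma>))))"
    by (rule sums_unique2)
  also have "\<dots> = 1 / (\<gamma> + rate / c * h)"
    using \<gamma>_pos by (simp add: field_simps)
  also have "\<gamma> + rate / c * h = (c * \<beta> + rate * (h - 1) - q) / c"
    using c_pos by (simp add: \<gamma>_def field_simps)
  finally show "(LBINT y. exp (- \<beta> * y) * S y) = c / (c * \<beta> + rate * (h - 1) - q)"
    by simp
qed

end

section \<open>Identification of the primitive of the scale function\<close>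

theorem proposition4p6:
  fixes M :: "'a measure" and N :: "real \<Rightarrow> 'a \<Rightarrow> nat" and \<xi> :: "nat \<Rightarrow> 'a \<Rightarrow> real"
    and \<nu> :: "real measure" and c rate q x :: real and W :: "real \<Rightarrow> real"
  assumes "negative_compound_poisson M N rate \<xi> \<nu> c"
    and "q \<ge> 0"
    and "is_scale_function (laplace_exponent M (cpp c N \<xi>)) q W"
    and "x \<ge> 0"
  shows "summable (\<lambda>k. LINT s:{0..<x}|conv_power \<nu> k. (LBINT y:{s..x}. g c rate q k s y)) \<and>
         (LBINT y:{0..x}. W y) =
           1 / c * (\<Sum>k. LINT s:{0..<x}|conv_power \<nu> k. (LBINT y:{s..x}. g c rate q k s y))"
proof -
  interpret L: negative_compound_poisson M N rate \<xi> \<nu> c by fact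
  interpret scale_measures c rate q "conv_power \<nu>"
    by (intro scale_measures.intro scale_parameters.intro scale_measures_axioms.intro
        prob_space_conv_power sets_conv_power L.\<nu>_prob L.\<nu>_sets L.drift_pos L.rate_pos assms(2))
  define \<psi> where "\<psi> = laplace_exponent M (cpp c N \<xi>)"
  \<comment> \<open>Above \<open>B\<close> everything is available: the formula for
    \<open>\<psi>\<close> needs \<open>\<beta> \<ge> 0\<close>, the transform of \<open>S\<close>
    needs \<open>growth < \<beta>\<close>, and that of \<open>W\<close> needs \<open>\<beta>\<close>
    beyond the right inverse.\<close>
  define B where "B = max (max 0 growth) (right_inverse \<psi> q)"
  have W_cont: "continuous_on {0..} W"
    and W_int: "set_integrable lborel {0..} (\<lambda>y. exp (- \<beta> * y) * W y)"
    and W_transform: "(LBINT y:{0..}. exp (- \<beta> * y) * W y) = 1 / (\<psi> \<beta> - q)"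
    if "B < \<beta>" for \<beta>
    using assms(3) that by (simp_all add: is_scale_function_def \<psi>_def B_def)
  have S_int: "set_integrable lborel {0..} (\<lambda>y. exp (- \<beta> * y) * S y)"
    and S_transform: "(LBINT y:{0..}. exp (- \<beta> * y) * S y) = c / (\<psi> \<beta> - q)"
    if \<beta>: "B < \<beta>" for \<beta>
  proof -
    define h where "h = (LINT s|\<nu>. exp (- \<beta> * s))"
    have \<beta>': "0 \<le> \<beta>" "growth < \<beta>" using \<beta> by (auto simp: B_def)
    have int: "integrable \<nu> (\<lambda>s. exp (- \<beta> * s))"
      by (rule integrable_exp_neg[OF L.\<nu>_prob L.\<nu>_sets L.AE_\<nu>_nonneg \<beta>'(1)])
    have h: "0 \<le> h" "h \<le> 1"
    proof -
      interpret \<nu>: prob_space \<nu> by (rule L.\<nu>_prob)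
      show "0 \<le> h" by (simp add: h_def)
      have "AE s in \<nu>. exp (- \<beta> * s) \<le> 1"
        using L.AE_\<nu>_nonneg by eventually_elim (use \<beta>'(1) in simp)
      then show "h \<le> 1"
        unfolding h_def using int by (rule \<nu>.integral_le_const[rotated])
    qed
    have laplace: "(LINT s|conv_power \<nu> k. exp (- \<beta> * s)) = h ^ k" for k
      unfolding h_def by (rule integral_conv_power_exp[OF L.\<nu>_prob L.\<nu>_sets L.AE_\<nu>_nonneg \<beta>'(1)])
    have pos: "AE s in conv_power \<nu> k. 0 \<le> s" for k
      by (rule AE_conv_power_nonneg[OF L.\<nu>_prob L.\<nu>_sets L.AE_\<nu>_nonneg])
    have eq: "indicator {0..} y *\<^sub>R (exp (- \<beta> * y) * S y) = exp (- \<beta> * y) * S y" for y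
      by (auto simp: S_eq_0 split: split_indicator)
    show "set_integrable lborel {0..} (\<lambda>y. exp (- \<beta> * y) * S y)"
      unfolding set_integrable_def eq by (rule integrable_exp_S[OF \<beta>'(2) pos laplace h])
    have "\<psi> \<beta> = c * \<beta> + rate * (h - 1)"
      unfolding \<psi>_def h_def by (rule L.laplace_exponent_cpp[OF \<beta>'(1)])
    then show "(LBINT y:{0..}. exp (- \<beta> * y) * S y) = c / (\<psi> \<beta> - q)"
      unfolding set_lebesgue_integral_def eq
      by (simp only: laplace_transform_S[OF \<beta>'(2) pos laplace h])
  qed
  \<comment> \<open>Injectivity is applied to the difference, whose transform vanishes on the whole
    ray above \<open>B\<close>.\<close>
  have "(LBINT y:{0..x}. W y - 1 / c * S y) = 0"
  proof (rule laplace_transform_eq_0_imp_integral_eq_0[OF _ _ assms(4)])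
    fix \<beta> :: real
    assume \<beta>: "B < \<beta>"
    have split: "exp (- \<beta> * y) * (W y - 1 / c * S y) =
        exp (- \<beta> * y) * W y - 1 / c * (exp (- \<beta> * y) * S y)" for y
      by (simp add: right_diff_distrib)
    have S_int': "set_integrable lborel {0..} (\<lambda>y. 1 / c * (exp (- \<beta> * y) * S y))"
      by (intro set_integrable_mult_right S_int[OF \<beta>])
    show "set_integrable lborel {0..} (\<lambda>y. exp (- \<beta> * y) * (W y - 1 / c * S y))"
      unfolding split by (rule set_integral_diff(1)[OF W_int[OF \<beta>] S_int'])
    have "(LBINT y:{0..}. 1 / c * (exp (- \<beta> * y) * S y)) = 1 / (\<psi> \<beta> - q)"
      by (simp only: set_integral_mult_right S_transform[OF \<beta>]) (use L.drift_pos in simp)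
    then show "(LBINT y:{0..}. exp (- \<beta> * y) * (W y - 1 / c * S y)) = 0"
      unfolding split set_integral_diff(2)[OF W_int[OF \<beta>] S_int'] by (simp only: W_transform[OF \<beta>] diff_self)
  qed
  moreover have "(LBINT y:{0..x}. W y - 1 / c * S y) = (LBINT y:{0..x}. W y) - 1 / c * (LBINT y:{0..x}. S y)"
  proof -
    have "set_integrable lborel {0..x} W"
      \<comment> \<open>Continuity was recorded under the shared premise \<open>B < \<beta>\<close>;
        \<open>B + 1\<close> is a value satisfying it.\<close>
      using continuous_on_subset[OF W_cont[of "B + 1"], of "{0..x}"] by (intro borel_integrable_atLeastAtMost') auto
    moreover have "set_integrable lborel {0..x} (\<lambda>y. 1 / c * S y)"
      by (intro set_integrable_mult_right set_integrable_S assms(4))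
    ultimately show ?thesis
      by (simp only: set_integral_diff(2) set_integral_mult_right)
  qed
  ultimately have W_eq: "(LBINT y:{0..x}. W y) = 1 / c * (LBINT y:{0..x}. S y)"
    by simp
  show ?thesis
    using primitive_S_sums[OF assms(4)] unfolding sums_iff W_eq by simp
qed

end
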